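(* Let $d\ge1$. Suppose that $S:\mathbb{Z}^d\to[0,\infty)$ satisfies Assumption 1 and the weakened Assumption 2 (stated in the context). Then the function $|\cdot|_S:\mathbb{R}^d\to[0,\infty)$ defined by $|0|_S=0$ and $$|x|_S=\frac{\mu_{\hat x}\cdot x}{m_S}\qquad(x\ne0)$$ is a norm, and it satisfies $\|x\|_\infty\le|x|_S\le\|x\|_1$ for every $x\in\mathbb{R}^d$.
   Context: Notation. $|x|=\|x\|_2$ is the Euclidean norm on $\mathbb{R}^d$; $\hat x=x/|x|$; $a\wedge b=\min\{a,b\}$; $e_1,\dots,e_d$ is the standard basis; $\mathbb{T}^d$ is the $d$-dimensional torus of period $2\pi$. For $f,g:\mathbb{Z}^d\to\mathbb{R}$: $\hat f(k)=\sum_{x}f(x)e^{-ik\cdot x}$, $(f*g)(x)=\sum_{y}f(x-y)g(y)$, and $\|f(y)\|_p$ is the $\ell^p(\mathbb{Z}^d)$ norm. $f$ is $\mathbb{Z}^d$-symmetric if $f(x)$ is unchanged when a component of $x$ is multiplied by $-1$ or the components of $x$ are permuted. The exponential tilt of $f$ by $\mu\in\mathbb{R}^d$ is $f^{(\mu)}(x)=f(x)e^{\mu\cdot x}$. For $S:\mathbb{Z}^d\to[0,\infty)$ let $\chi^{(\mu)}=\sum_{x}S^{(\mu)}(x)$, $\Omega=\{\mu\in\mathbb{R}^d:\chi^{(\mu)}<\infty\}$, with closure $\overline\Omega$ and boundary $\partial\Omega$, and $m_S=\sup\{t\ge0:\chi^{(te_1)}<\infty\}$ (which lies in $(0,\infty)$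 under Assumption 1). Assumption 1: $S$ is $\mathbb{Z}^d$-symmetric, $\Omega$ is an open set containing $0$, and $\mu_1e_1\notin\Omega$ for some $\mu_1>0$. Weakened Assumption 2: there are constants $M,K_{\mathrm{IR}},\zeta>0$ such that $S=h+J*S$ with $\mathbb{Z}^d$-symmetric $J,h\in\ell^1(\mathbb{Z}^d)$; for every $\mu\in\overline\Omega$ one has $\hat h^{(\mu)}(0)>0$ and the pair $(Q,g)=(J^{(\mu)},h^{(\mu)})$ satisfies, with the same constants for all $\mu$, (a) $\|Q(y)\|_1\le M$ and $\||y|^{2+\zeta}Q(y)\|_1\le M$; (b) $\mathrm{Re}[\hat Q(0)-\hat Q(k)]\ge K_{\mathrm{IR}}|k|^2$ for $k\in\mathbb{T}^d$ (represented in $[-\pi,\pi]^d$); (c) $\|g(y)\|_1\le M$, $\||y|^{\zeta}g(y)\|_1\le M$, $\||y|^2g(y)\|_{p_d\wedge2}\le M$, where $p_d=2$ for $d=1$ and $p_d=\frac{d}{d-2+(\zeta\wedge2)}$ for $d\ge2$. Under these assumptions, for each nonzero $x\in\mathbb{R}^d$ the maximum $\max_{\mu\in\overline\Omega}\mu\cdot x$ is attained at a unique point $\mu_{\hat x}\in\partial\Omega$, depending only on $\hat x$. *)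

theory Defs
  imports "HOL-Analysis.Analysis"
begin

text \<open>
  The lattice \<open>\<int>\<^sup>d\<close> is the type \<^typ>\<open>int^'d\<close> and \<open>\<real>\<^sup>d\<close> is \<^typ>\<open>real^'d\<close>, with \<open>d = CARD('d)\<close>.
  A finite index type has no distinguished first element, so the coordinate that plays the
  role of \<open>1\<close> in \<open>e\<^sub>1\<close> is an explicit parameter \<open>i\<close> below, and \<open>e\<^sub>1\<close> is \<^term>\<open>axis i 1\<close>.
\<close>

definition rvec :: "int^'d \<Rightarrow> real^'d::finite" where
  "rvec x = (\<chi> j. real_of_int (x $ j))"

definition fourier :: "(int^'d::finite \<Rightarrow> real) \<Rightarrow> real^'d \<Rightarrow> complex" where
  "fourier f k = (\<Sum>\<^sub>\<infinity>x. of_real (f x) * exp (- \<i> * of_real (k \<bullet> rvec x)))"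

definition conv :: "(int^'d::finite \<Rightarrow> real) \<Rightarrow> (int^'d \<Rightarrow> real) \<Rightarrow> int^'d \<Rightarrow> real" where
  "conv f g x = (\<Sum>\<^sub>\<infinity>y. f (x - y) * g y)"

definition lp_norm :: "real \<Rightarrow> (int^'d::finite \<Rightarrow> real) \<Rightarrow> ennreal" where
  "lp_norm p f =
     (if (\<lambda>y. \<bar>f y\<bar> powr p) summable_on UNIV
      then ennreal ((\<Sum>\<^sub>\<infinity>y. \<bar>f y\<bar> powr p) powr (1 / p))
      else \<infinity>)"

definition zd_symmetric :: "(int^'d::finite \<Rightarrow> real) \<Rightarrow> bool" where
  "zd_symmetric f \<longleftrightarrow>
     (\<forall>j x. f (\<chi> l. if l = j then - (x $ l) else x $ l) = f x) \<and>
     (\<forall>\<pi> x. bij \<pi> \<longrightarrow> f (\<chi> l. x $ \<pi> l) = f x)"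

definition tilt :: "(int^'d::finite \<Rightarrow> real) \<Rightarrow> real^'d \<Rightarrow> int^'d \<Rightarrow> real" where
  "tilt f \<mu> x = f x * exp (\<mu> \<bullet> rvec x)"

text \<open>
  The next three definitions are meant for nonnegative \<open>S\<close>; \<^const>\<open>ennreal\<close> would truncate
  negative summands to \<open>0\<close>.
\<close>

definition chi :: "(int^'d::finite \<Rightarrow> real) \<Rightarrow> real^'d \<Rightarrow> ennreal" where
  "chi S \<mu> = (\<Sum>\<^sub>\<infinity>x. ennreal (tilt S \<mu> x))"

definition Omega :: "(int^'d::finite \<Rightarrow> real) \<Rightarrow> (real^'d) set" where
  "Omega S = {\<mu>. chi S \<mu> < \<infinity>}"

definition mass :: "'d::finite \<Rightarrow> (int^'d \<Rightarrow> real) \<Rightarrow> real" where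
  "mass i S = Sup {t. 0 \<le> t \<and> chi S (t *\<^sub>R axis i 1) < \<infinity>}"

definition assumption1 :: "'d::finite \<Rightarrow> (int^'d \<Rightarrow> real) \<Rightarrow> bool" where
  "assumption1 i S \<longleftrightarrow>
     zd_symmetric S \<and> open (Omega S) \<and> 0 \<in> Omega S \<and>
     (\<exists>\<mu>\<^sub>1>0. \<mu>\<^sub>1 *\<^sub>R axis i 1 \<notin> Omega S)"

definition p_exp :: "nat \<Rightarrow> real \<Rightarrow> real" where
  "p_exp d \<zeta> = (if d = 1 then 2 else real d / (real d - 2 + min \<zeta> 2))"

definition tilt_bounds ::
    "real \<Rightarrow> real \<Rightarrow> real \<Rightarrow> (int^'d::finite \<Rightarrow> real) \<Rightarrow> (int^'d \<Rightarrow> real) \<Rightarrow> bool" where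
  "tilt_bounds M K \<zeta> Q g \<longleftrightarrow>
     lp_norm 1 Q \<le> ennreal M \<and>
     lp_norm 1 (\<lambda>y. norm (rvec y) powr (2 + \<zeta>) * Q y) \<le> ennreal M \<and>
     (\<forall>k. (\<forall>j. - pi \<le> k $ j \<and> k $ j \<le> pi) \<longrightarrow>
        Re (fourier Q 0 - fourier Q k) \<ge> K * (norm k)\<^sup>2) \<and>
     lp_norm 1 g \<le> ennreal M \<and>
     lp_norm 1 (\<lambda>y. norm (rvec y) powr \<zeta> * g y) \<le> ennreal M \<and>
     lp_norm (min (p_exp CARD('d) \<zeta>) 2) (\<lambda>y. (norm (rvec y))\<^sup>2 * g y) \<le> ennreal M"

text \<open>
  A Fourier transform at \<open>0\<close> of a real function is real, so its positivity is expressed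
  through \<^const>\<open>Re\<close>.
\<close>

definition weak_assumption2 :: "(int^'d::finite \<Rightarrow> real) \<Rightarrow> bool" where
  "weak_assumption2 S \<longleftrightarrow>
     (\<exists>M>0. \<exists>K>0. \<exists>\<zeta>>0. \<exists>J h.
        zd_symmetric J \<and> zd_symmetric h \<and> lp_norm 1 J < \<infinity> \<and> lp_norm 1 h < \<infinity> \<and>
        (\<forall>x. S x = h x + conv J S x) \<and>
        (\<forall>\<mu>\<in>closure (Omega S).
           Re (fourier (tilt h \<mu>) 0) > 0 \<and> tilt_bounds M K \<zeta> (tilt J \<mu>) (tilt h \<mu>)))"

definition mu_dir :: "(int^'d::finite \<Rightarrow> real) \<Rightarrow> real^'d \<Rightarrow> real^'d" where
  "mu_dir S u = (THE \<mu>. is_arg_max (\<lambda>\<nu>. \<nu> \<bullet> u) (\<lambda>\<nu>. \<nu> \<in> closure (Omega S)) \<mu>)"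

text \<open>Here \<^term>\<open>sgn x\<close> is the unit vector \<open>x / |x|\<close>.\<close>

definition norm_S :: "'d::finite \<Rightarrow> (int^'d \<Rightarrow> real) \<Rightarrow> real^'d \<Rightarrow> real" where
  "norm_S i S x = (if x = 0 then 0 else mu_dir S (sgn x) \<bullet> x / mass i S)"

definition is_norm :: "('a::real_vector \<Rightarrow> real) \<Rightarrow> bool" where
  "is_norm N \<longleftrightarrow>
     (\<forall>x. 0 \<le> N x) \<and>
     (\<forall>x. N x = 0 \<longleftrightarrow> x = 0) \<and>
     (\<forall>c x. N (c *\<^sub>R x) = \<bar>c\<bar> * N x) \<and>
     (\<forall>x y. N (x + y) \<le> N x + N y)"

end

theory Submission
  imports Defs "HOL-Real_Asymp.Real_Asymp"
begin

text \<open>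
  Write \<open>\<chi>(\<mu>)\<close>, \<open>J(\<mu>)\<close>, \<open>h(\<mu>)\<close> for the total sums of \<open>S\<close>, \<open>J\<close>, \<open>h\<close> tilted by \<open>\<mu>\<close>.
  Summing the convolution equation gives \<open>\<chi>(\<mu>) (1 - J(\<mu>)) = h(\<mu>)\<close> on \<open>\<Omega>\<close>. Since \<open>\<Omega>\<close> is open,
  \<open>\<chi>\<close> diverges at its boundary while \<open>h\<close> stays bounded, so \<open>J(\<mu>) = 1\<close> on \<open>\<partial>\<Omega>\<close>. The infrared
  bound makes \<open>J\<close> strictly convex, even though the kernel may change sign, so \<open>\<partial>\<Omega>\<close> contains no
  segment and every linear functional has a unique maximiser on the closure of \<open>\<Omega>\<close>. Hence
  \<open>m\<^sub>S |x|\<^sub>S\<close> is the support function of a compact, symmetric convex body with \<open>0\<close> in its interior.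
  By lattice symmetry that body lies between the \<open>\<ell>\<^sup>1\<close> ball and the \<open>\<ell>\<^sup>\<infinity>\<close> ball of radius \<open>m\<^sub>S\<close>.
\<close>

section \<open>Sums over the lattice\<close>

lemma integrable_count_space_iff_summable_on:
  fixes f :: "'a \<Rightarrow> real"
  shows "integrable (count_space A) f \<longleftrightarrow> f summable_on A"
  using abs_summable_equivalent[of f A] summable_on_iff_abs_summable_on_real[of f A]
  by (simp add: Infinite_Set_Sum.abs_summable_on_def)

lemma integral_count_space_eq_infsum:
  fixes f :: "'a \<Rightarrow> real"
  assumes "f summable_on A"
  shows "integral\<^sup>L (count_space A) f = infsum f A"
  using assms infsetsum_infsum[of f A] integrable_count_space_iff_summable_on[of A f]
  by (simp add: Infinite_Set_Sum.abs_summable_on_def infsetsum_def)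

lemma summable_on_bounded:
  fixes f g :: "'a \<Rightarrow> real"
  assumes "g summable_on A" "\<And>x. x \<in> A \<Longrightarrow> \<bar>f x\<bar> \<le> g x"
  shows "f summable_on A"
proof -
  have "(\<lambda>x. norm (f x)) summable_on A"
    by (rule summable_on_comparison_test[OF assms(1)]) (use assms(2) in auto)
  then show ?thesis
    using summable_on_iff_abs_summable_on_real by blast
qed

text \<open>Lebesgue's theorem for counting measure. It gives the continuity of the kernel's mass
  along a ray and both second-difference limits below.\<close>

lemma infsum_dominated_convergence:
  fixes f :: "nat \<Rightarrow> 'a \<Rightarrow> real"
  assumes g: "g summable_on UNIV" and bound: "\<And>n x. \<bar>f n x\<bar> \<le> g x"
    and lim: "\<And>x. (\<lambda>n. f n x) \<longlonglongrightarrow> l x"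
  shows "l summable_on UNIV" "(\<lambda>n. infsum (f n) UNIV) \<longlonglongrightarrow> infsum l UNIV"
proof -
  have "\<bar>l x\<bar> \<le> g x" for x
    by (rule tendsto_upperbound[OF tendsto_rabs[OF lim]]) (auto simp: bound)
  then show l: "l summable_on UNIV"
    by (rule summable_on_bounded[OF g])
  have f: "f n summable_on UNIV" for n
    using bound by (rule summable_on_bounded[OF g])
  have "(\<lambda>n. integral\<^sup>L (count_space UNIV) (f n)) \<longlonglongrightarrow> integral\<^sup>L (count_space UNIV) l"
    by (rule integral_dominated_convergence[where w=g])
      (use g bound lim in \<open>auto simp: integrable_count_space_iff_summable_on\<close>)
  then show "(\<lambda>n. infsum (f n) UNIV) \<longlonglongrightarrow> infsum l UNIV"
    by (simp add: integral_count_space_eq_infsum f l)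
qed

text \<open>Fubini: the products \<open>f z * g y\<close> are absolutely summable over all pairs, so
  their sum factorises and may also be grouped by \<open>y + z\<close>.\<close>

lemma has_sum_conv:
  fixes f g :: "int^'d::finite \<Rightarrow> real"
  assumes f: "f summable_on UNIV" and g: "g summable_on UNIV"
  shows "(conv f g has_sum infsum f UNIV * infsum g UNIV) UNIV"
proof -
  have absf: "(\<lambda>x. \<bar>f x\<bar>) summable_on UNIV" and absg: "(\<lambda>x. \<bar>g x\<bar>) summable_on UNIV"
    using f g summable_on_iff_abs_summable_on_real[of f UNIV]
      summable_on_iff_abs_summable_on_real[of g UNIV] by auto
  let ?p = "\<lambda>(y, z). f z * g y"
  have "(\<lambda>(y, z). \<bar>f z\<bar> * \<bar>g y\<bar>) summable_on (SIGMA y:UNIV. UNIV)"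
    by (rule summable_on_SigmaI[where g = "\<lambda>y. infsum (\<lambda>z. \<bar>f z\<bar>) UNIV * \<bar>g y\<bar>"])
      (auto intro!: has_sum_cmult_left has_sum_infsum summable_on_cmult_right absf absg)
  then have p: "?p summable_on UNIV \<times> UNIV"
    by (rule summable_on_bounded) (auto simp: abs_mult)
  have "(?p has_sum infsum ?p (UNIV \<times> UNIV)) (UNIV \<times> UNIV)"
    using p by simp
  then have "((\<lambda>y. infsum f UNIV * g y) has_sum infsum ?p (UNIV \<times> UNIV)) UNIV"
    by (rule has_sum_SigmaD) (auto intro!: has_sum_cmult_left has_sum_infsum f)
  from infsumI[OF this] have eq: "infsum ?p (UNIV \<times> UNIV) = infsum f UNIV * infsum g UNIV"
    by (simp add: infsum_cmult_right')
  \<comment> \<open>The shear substitutes \<open>z = x - y\<close>, so that the fibre over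
    \<open>x\<close> carries exactly the terms of \<open>conv f g x\<close>.\<close>
  have bij: "bij_betw (\<lambda>(x, y). (y, x - y)) (UNIV \<times> UNIV :: ((int^'d) \<times> (int^'d)) set) (UNIV \<times> UNIV)"
    by (rule bij_betwI[where g = "\<lambda>(y, z). (z + y, y)"]) auto
  have q: "((\<lambda>(x, y). f (x - y) * g y) has_sum infsum ?p (UNIV \<times> UNIV)) (UNIV \<times> UNIV)"
    using has_sum_reindex_bij_betw[OF bij, of ?p "infsum ?p (UNIV \<times> UNIV)"] p
    by (simp add: case_prod_unfold)
  show ?thesis
    unfolding eq[symmetric]
  proof (rule has_sum_SigmaD[OF q])
    fix x
    have "(\<lambda>(x, y). f (x - y) * g y) summable_on (SIGMA x:UNIV. UNIV)"
      using q has_sum_imp_summable by fastforce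
    then have "(\<lambda>y. f (x - y) * g y) summable_on UNIV"
      by (rule summable_on_SigmaD1) auto
    then show "((\<lambda>y. case (x, y) of (x, y) \<Rightarrow> f (x - y) * g y) has_sum conv f g x) UNIV"
      by (simp add: conv_def)
  qed
qed

lemma rvec_diff: "rvec (x - y) = rvec x - rvec y"
  by (simp add: rvec_def vec_eq_iff)

lemma tilt_conv: "tilt (conv f g) \<mu> = conv (tilt f \<mu>) (tilt g \<mu>)"
proof
  fix x
  have "tilt f \<mu> (x - y) * tilt g \<mu> y = f (x - y) * g y * exp (\<mu> \<bullet> rvec x)" for y
    by (simp add: tilt_def rvec_diff inner_diff_right exp_diff)
  then show "tilt (conv f g) \<mu> x = conv (tilt f \<mu>) (tilt g \<mu>) x"
    by (simp add: conv_def infsum_cmult_left' tilt_def[of "conv f g"] flip: infsum_cmult_left')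
qed

section \<open>Fourier transforms, norms and moments\<close>

lemma Re_fourier:
  assumes "f summable_on UNIV"
  shows "Re (fourier f k) = (\<Sum>\<^sub>\<infinity>x. f x * cos (k \<bullet> rvec x))"
proof -
  let ?g = "\<lambda>x. of_real (f x) * exp (- \<i> * of_real (k \<bullet> rvec x))"
  have "(\<lambda>x. norm (?g x)) summable_on UNIV"
    using assms summable_on_iff_abs_summable_on_real[of f UNIV]
    by (simp add: norm_mult norm_exp_eq_Re)
  then have "?g summable_on UNIV"
    by (rule abs_summable_summable)
  then show ?thesis
    unfolding fourier_def by (subst infsum_Re[symmetric]) (auto simp: Re_exp)
qed

lemma lp_norm_1_le:
  assumes "lp_norm 1 f \<le> ennreal M" "M > 0"
  shows "(\<lambda>x. \<bar>f x\<bar>) summable_on UNIV" "(\<Sum>\<^sub>\<infinity>x. \<bar>f x\<bar>) \<le> M" "f summable_on UNIV"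
proof -
  show *: "(\<lambda>x. \<bar>f x\<bar>) summable_on UNIV"
    using assms by (auto simp: lp_norm_def top_unique split: if_splits)
  then show "f summable_on UNIV"
    by (rule summable_on_bounded) auto
  have "0 \<le> (\<Sum>\<^sub>\<infinity>x. \<bar>f x\<bar>)"
    by (rule infsum_nonneg) auto
  then show "(\<Sum>\<^sub>\<infinity>x. \<bar>f x\<bar>) \<le> M"
    using assms * by (auto simp: lp_norm_def)
qed

lemma norm_rvec_ge_1:
  assumes "x \<noteq> 0"
  shows "norm (rvec x) \<ge> 1"
proof -
  obtain j where "x $ j \<noteq> 0"
    using assms by (auto simp: vec_eq_iff)
  then have "1 \<le> \<bar>rvec x $ j\<bar>"
    by (simp add: rvec_def)
  also have "\<dots> \<le> norm (rvec x)"
    by (rule component_le_norm_cart)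
  finally show ?thesis .
qed

lemma rvec_0 [simp]: "rvec 0 = 0"
  by (simp add: rvec_def vec_eq_iff)

text \<open>Nonzero lattice points have norm at least 1, so the exponent can be raised from 2 to
  \<open>2 + \<zeta>\<close>; at the origin both weights vanish.\<close>

lemma second_moment_summable:
  fixes Q :: "int^'d::finite \<Rightarrow> real"
  assumes "lp_norm 1 (\<lambda>y. norm (rvec y) powr (2 + \<zeta>) * Q y) \<le> ennreal M" "M > 0" "\<zeta> > 0"
  shows "(\<lambda>y. (norm (rvec y))\<^sup>2 * \<bar>Q y\<bar>) summable_on UNIV"
proof (rule summable_on_bounded[OF lp_norm_1_le(1)[OF assms(1,2)]])
  fix y :: "int^'d"
  have "(norm (rvec y))\<^sup>2 \<le> norm (rvec y) powr (2 + \<zeta>)"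
  proof (cases "y = 0")
    case False
    then have "norm (rvec y) powr 2 \<le> norm (rvec y) powr (2 + \<zeta>)"
      using norm_rvec_ge_1[OF False] assms(3) by (intro powr_mono) auto
    then show ?thesis
      using norm_rvec_ge_1[OF False] by (simp add: powr_numeral)
  qed auto
  then show "\<bar>(norm (rvec y))\<^sup>2 * \<bar>Q y\<bar>\<bar> \<le> \<bar>norm (rvec y) powr (2 + \<zeta>) * Q y\<bar>"
    by (simp add: abs_mult mult_right_mono)
qed

section \<open>Quadratic bounds for \<open>cos\<close> and \<open>cosh\<close>\<close>

lemma one_minus_cos_le: "1 - cos a \<le> a\<^sup>2 / 2" for a :: real
proof -
  have "\<bar>sin (a / 2)\<bar> \<le> \<bar>a / 2\<bar>"
    by (rule abs_sin_x_le_abs_x)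
  then have "(sin (a / 2))\<^sup>2 \<le> (a / 2)\<^sup>2"
    by (simp only: abs_le_square_iff)
  moreover have "cos a = 1 - 2 * (sin (a / 2))\<^sup>2"
    using cos_double_sin[of "a / 2"] by simp
  ultimately show ?thesis
    by (simp add: power_divide)
qed

lemma sinh_le_mult_cosh:
  fixes x :: real
  assumes "x \<ge> 0"
  shows "sinh x \<le> x * cosh x"
proof -
  have "0 * cosh 0 - sinh 0 \<le> x * cosh x - sinh x"
  proof (rule DERIV_nonneg_imp_nondecreasing[OF assms])
    fix t :: real assume "0 \<le> t"
    show "\<exists>y. ((\<lambda>t. t * cosh t - sinh t) has_real_derivative y) (at t) \<and> 0 \<le> y"
      by (rule exI[of _ "t * sinh t"])
        (use \<open>0 \<le> t\<close> in \<open>auto intro!: derivative_eq_intros\<close>)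
  qed
  then show ?thesis by simp
qed

text \<open>With b = |a|/2 the left side is 2 (sinh b)^2, and sinh b is at most b cosh b. The bound
  later dominates second differences in a tilt direction.\<close>

lemma cosh_minus_1_le: "cosh a - 1 \<le> a\<^sup>2 / 2 * cosh a" for a :: real
proof -
  define b where "b = \<bar>a\<bar> / 2"
  have "b \<ge> 0" and ab: "cosh a = cosh (2 * b)" "a\<^sup>2 = 4 * b\<^sup>2"
    by (auto simp: b_def abs_if power_divide)
  have c: "cosh (2 * b) = (cosh b)\<^sup>2 + (sinh b)\<^sup>2" "(cosh b)\<^sup>2 = (sinh b)\<^sup>2 + 1"
    by (auto simp: cosh_double cosh_square_eq)
  have "(sinh b)\<^sup>2 \<le> (b * cosh b)\<^sup>2"
    using sinh_le_mult_cosh[OF \<open>b \<ge> 0\<close>] \<open>b \<ge> 0\<close> by (intro power_mono) auto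
  also have "\<dots> \<le> b\<^sup>2 * cosh (2 * b)"
    by (auto simp: c(1) power_mult_distrib intro!: mult_left_mono)
  finally show ?thesis
    unfolding ab using c by simp
qed

section \<open>Strict convexity of the domain\<close>

text \<open>Replaces the extended-real sum \<open>chi\<close> by real summability: for nonnegative
  terms both mean that the finite partial sums are bounded.\<close>

lemma Omega_iff_summable:
  assumes "\<And>x. S x \<ge> 0"
  shows "\<mu> \<in> Omega S \<longleftrightarrow> tilt S \<mu> summable_on UNIV"
proof
  have nonneg: "tilt S \<mu> x \<ge> 0" for x
    using assms by (simp add: tilt_def)
  have chi: "chi S \<mu> = (SUP F\<in>{F. finite F}. ennreal (sum (tilt S \<mu>) F))"
    unfolding chi_def by (subst nonneg_infsum_complete) (simp_all add: sum_ennreal nonneg)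
  show "tilt S \<mu> summable_on UNIV" if "\<mu> \<in> Omega S"
  proof (rule nonneg_bdd_above_summable_on)
    show "bdd_above (sum (tilt S \<mu>) ` {F. F \<subseteq> UNIV \<and> finite F})"
    proof (rule bdd_aboveI2)
      fix F :: "(int^'a) set" assume "F \<in> {F. F \<subseteq> UNIV \<and> finite F}"
      then have "ennreal (sum (tilt S \<mu>) F) \<le> chi S \<mu>"
        unfolding chi by (intro SUP_upper) auto
      moreover have "chi S \<mu> < top"
        using that by (simp add: Omega_def)
      ultimately have "enn2real (ennreal (sum (tilt S \<mu>) F)) \<le> enn2real (chi S \<mu>)"
        by (rule enn2real_mono)
      then show "sum (tilt S \<mu>) F \<le> enn2real (chi S \<mu>)"
        by (simp add: sum_nonneg nonneg)
    qed
  qed (use nonneg in auto)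
  show "\<mu> \<in> Omega S" if "tilt S \<mu> summable_on UNIV"
  proof -
    have "chi S \<mu> = ennreal (infsum (tilt S \<mu>) UNIV)"
      using infsum_nonneg_is_SUPREMUM_ennreal[OF that nonneg] chi by simp
    then show ?thesis
      by (simp add: Omega_def)
  qed
qed

text \<open>A crude consequence of convexity: a tilt at a point of a segment is dominated by the sum
  of the tilts at its ends.\<close>

lemma exp_convex_le:
  fixes a b :: real
  assumes "0 \<le> u" "0 \<le> v" "u + v = 1"
  shows "exp (u * a + v * b) \<le> exp a + exp b"
proof -
  have "u * a + v * b \<le> max a b"
    by (rule convex_bound_le) (use assms in auto)
  then have "exp (u * a + v * b) \<le> exp (max a b)"
    by simp
  also have "\<dots> \<le> exp a + exp b"
    by (simp add: max_def)
  finally show ?thesis .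
qed

lemma convex_Omega:
  assumes "\<And>x. S x \<ge> 0"
  shows "convex (Omega S)"
proof (rule convexI)
  fix \<mu> \<nu> and u v :: real
  assume *: "\<mu> \<in> Omega S" "\<nu> \<in> Omega S" "0 \<le> u" "0 \<le> v" "u + v = 1"
  have "(\<lambda>x. tilt S \<mu> x + tilt S \<nu> x) summable_on UNIV"
    using * by (intro summable_on_add) (simp_all add: Omega_iff_summable assms)
  moreover have "\<bar>tilt S (u *\<^sub>R \<mu> + v *\<^sub>R \<nu>) x\<bar> \<le> tilt S \<mu> x + tilt S \<nu> x" for x
    using exp_convex_le[OF *(3-5), of "\<mu> \<bullet> rvec x" "\<nu> \<bullet> rvec x"] assms[of x]
    by (simp add: tilt_def inner_add_left mult_left_mono abs_mult flip: distrib_left)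
  ultimately show "u *\<^sub>R \<mu> + v *\<^sub>R \<nu> \<in> Omega S"
    unfolding Omega_iff_summable[OF assms] by (rule summable_on_bounded)
qed

section \<open>The renewal equation and the kernel's mass on the boundary\<close>

locale weak_kernel =
  fixes S J h :: "int^'d::finite \<Rightarrow> real" and M K \<zeta> :: real
  assumes S_nonneg: "S x \<ge> 0"
    and open_Omega: "open (Omega S)"
    and zero_in_Omega: "0 \<in> Omega S"
    and renewal: "S x = h x + conv J S x"
    and M_pos: "M > 0" and K_pos: "K > 0" and \<zeta>_pos: "\<zeta> > 0"
    and h_hat_pos: "\<mu> \<in> closure (Omega S) \<Longrightarrow> Re (fourier (tilt h \<mu>) 0) > 0"
    and bounds: "\<mu> \<in> closure (Omega S) \<Longrightarrow> tilt_bounds M K \<zeta> (tilt J \<mu>) (tilt h \<mu>)"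
begin

lemma convex: "convex (Omega S)"
  by (rule convex_Omega) (rule S_nonneg)

lemma J_summable:
  assumes "\<mu> \<in> closure (Omega S)"
  shows "tilt J \<mu> summable_on UNIV"
  using bounds[OF assms] lp_norm_1_le M_pos unfolding tilt_bounds_def by blast

lemma h_summable:
  assumes "\<mu> \<in> closure (Omega S)"
  shows "tilt h \<mu> summable_on UNIV"
  using bounds[OF assms] lp_norm_1_le M_pos unfolding tilt_bounds_def by blast

lemma h_hat_bounds:
  assumes "\<mu> \<in> closure (Omega S)"
  shows "infsum (tilt h \<mu>) UNIV > 0" "infsum (tilt h \<mu>) UNIV \<le> M"
proof -
  show "infsum (tilt h \<mu>) UNIV > 0"
    using h_hat_pos[OF assms] by (simp add: Re_fourier h_summable assms)
  have *: "lp_norm 1 (tilt h \<mu>) \<le> ennreal M"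
    using bounds[OF assms] by (simp add: tilt_bounds_def)
  have "infsum (tilt h \<mu>) UNIV \<le> (\<Sum>\<^sub>\<infinity>x. \<bar>tilt h \<mu> x\<bar>)"
    by (rule infsum_mono[OF h_summable[OF assms] lp_norm_1_le(1)[OF * M_pos]]) auto
  then show "infsum (tilt h \<mu>) UNIV \<le> M"
    using lp_norm_1_le(2)[OF * M_pos] by linarith
qed

lemma chi_identity:
  assumes "\<mu> \<in> Omega S"
  shows "infsum (tilt S \<mu>) UNIV * (1 - infsum (tilt J \<mu>) UNIV) = infsum (tilt h \<mu>) UNIV"
proof -
  have cl: "\<mu> \<in> closure (Omega S)"
    using assms closure_subset by blast
  have S: "tilt S \<mu> summable_on UNIV"
    using assms by (simp add: Omega_iff_summable S_nonneg)
  have "tilt S \<mu> = (\<lambda>x. tilt h \<mu> x + conv (tilt J \<mu>) (tilt S \<mu>) x)"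
    by (subst tilt_conv[symmetric]) (simp add: fun_eq_iff tilt_def renewal[symmetric] flip: distrib_right)
  moreover have "((\<lambda>x. tilt h \<mu> x + conv (tilt J \<mu>) (tilt S \<mu>) x) has_sum
      infsum (tilt h \<mu>) UNIV + infsum (tilt J \<mu>) UNIV * infsum (tilt S \<mu>) UNIV) UNIV"
    by (intro has_sum_add has_sum_conv has_sum_infsum h_summable J_summable cl S)
  ultimately have "infsum (tilt S \<mu>) UNIV =
      infsum (tilt h \<mu>) UNIV + infsum (tilt J \<mu>) UNIV * infsum (tilt S \<mu>) UNIV"
    by (metis infsumI)
  then show ?thesis
    by (simp add: algebra_simps)
qed

text \<open>Approach \<open>\<mu>\<close> along the ray from \<open>0\<close>. The susceptibility must diverge, for otherwise
  Fatou's lemma would put \<open>\<mu>\<close> into the domain.\<close>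

lemma J_hat_boundary:
  assumes cl: "\<mu> \<in> closure (Omega S)" and "\<mu> \<notin> Omega S"
  shows "infsum (tilt J \<mu>) UNIV = 1"
proof -
  \<comment> \<open>These factors start at 0, stay below 1 and tend to 1. By convexity the shrunken
    points are therefore interior to the domain.\<close>
  define t where "t n = 1 - 1 / real (Suc n)" for n
  have t: "0 \<le> t n" "t n \<le> 1" for n
    by (auto simp: t_def field_simps)
  have "t \<longlonglongrightarrow> 1 - 0"
    unfolding t_def by (intro tendsto_diff tendsto_const LIMSEQ_inverse_real_of_nat[unfolded inverse_eq_divide])
  then have tlim: "t \<longlonglongrightarrow> 1" by simp
  have in_Omega: "t n *\<^sub>R \<mu> \<in> Omega S" for n
  proof -
    have "\<mu> - (1 / real (Suc n)) *\<^sub>R (\<mu> - 0) \<in> interior (Omega S)"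
      using open_Omega zero_in_Omega cl
      by (intro mem_interior_closure_convex_shrink[OF convex]) (auto simp: interior_open)
    then show ?thesis
      using open_Omega by (simp add: interior_open t_def scaleR_diff_left)
  qed
  then have cl': "t n *\<^sub>R \<mu> \<in> closure (Omega S)" for n
    using closure_subset by blast
  define \<phi> where "\<phi> \<nu> = infsum (tilt J \<nu>) UNIV" for \<nu>
  define X where "X n = infsum (tilt S (t n *\<^sub>R \<mu>)) UNIV" for n
  have tilt_lim: "(\<lambda>n. tilt f (t n *\<^sub>R \<mu>) x) \<longlonglongrightarrow> tilt f \<mu> x" for x and f :: "int^'d \<Rightarrow> real"
  proof -
    have "(\<lambda>n. tilt f (t n *\<^sub>R \<mu>) x) \<longlonglongrightarrow> tilt f (1 *\<^sub>R \<mu>) x"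
      unfolding tilt_def by (intro tendsto_intros tlim)
    then show ?thesis by simp
  qed
  have J0: "tilt J 0 summable_on UNIV"
    using zero_in_Omega closure_subset by (intro J_summable) blast
  have \<phi>_lim: "(\<lambda>n. \<phi> (t n *\<^sub>R \<mu>)) \<longlonglongrightarrow> \<phi> \<mu>"
    unfolding \<phi>_def
  proof (rule infsum_dominated_convergence)
    show "(\<lambda>x. \<bar>tilt J 0 x\<bar> + \<bar>tilt J \<mu> x\<bar>) summable_on UNIV"
      using J0 J_summable[OF cl] summable_on_iff_abs_summable_on_real[of "tilt J 0" UNIV]
        summable_on_iff_abs_summable_on_real[of "tilt J \<mu>" UNIV]
      by (intro summable_on_add) auto
    fix n x
    have "exp (t n * (\<mu> \<bullet> rvec x)) \<le> 1 + exp (\<mu> \<bullet> rvec x)"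
      using exp_convex_le[of "1 - t n" "t n" 0 "\<mu> \<bullet> rvec x"] t[of n] by simp
    from mult_left_mono[OF this, of "\<bar>J x\<bar>"]
    show "\<bar>tilt J (t n *\<^sub>R \<mu>) x\<bar> \<le> \<bar>tilt J 0 x\<bar> + \<bar>tilt J \<mu> x\<bar>"
      by (simp add: tilt_def abs_mult distrib_left)
  qed (rule tilt_lim)
  have id: "X n * (1 - \<phi> (t n *\<^sub>R \<mu>)) = infsum (tilt h (t n *\<^sub>R \<mu>)) UNIV" for n
    using chi_identity[OF in_Omega] by (simp add: X_def \<phi>_def)
  have X_nonneg: "X n \<ge> 0" for n
    unfolding X_def by (rule infsum_nonneg) (simp add: tilt_def S_nonneg)
  \<comment> \<open>The product in \<open>id\<close> is positive and its first factor nonnegative,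
    which forces the second factor to be positive.\<close>
  have \<phi>_less: "\<phi> (t n *\<^sub>R \<mu>) < 1" for n
    using id[of n] h_hat_bounds(1)[OF cl'[of n]] X_nonneg[of n]
    by (metis diff_gt_0_iff_gt zero_less_mult_pos order_le_less mult_zero_left less_irrefl)
  have "\<phi> \<mu> \<le> 1"
    using \<phi>_less by (intro LIMSEQ_le_const2[OF \<phi>_lim]) (auto intro: less_imp_le)
  moreover have False if less: "\<phi> \<mu> < 1"
  proof -
    \<comment> \<open>Half the gap below 1: eventually \<open>1 - \<phi>\<close> exceeds
      \<open>\<delta>\<close> along the ray, so the identity bounds the susceptibility by
      \<open>M / \<delta>\<close>.\<close>
    define \<delta> where "\<delta> = (1 - \<phi> \<mu>) / 2"
    have \<delta>: "\<delta> > 0" "\<phi> \<mu> < 1 - \<delta>"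
      using less by (auto simp: \<delta>_def field_simps)
    have ev: "\<forall>\<^sub>F n in sequentially. X n \<le> M / \<delta>"
      using order_tendstoD(2)[OF \<phi>_lim \<delta>(2)]
    proof eventually_elim
      case (elim n)
      have "X n * \<delta> \<le> X n * (1 - \<phi> (t n *\<^sub>R \<mu>))"
        using elim X_nonneg by (intro mult_left_mono) auto
      also have "\<dots> \<le> M"
        using id h_hat_bounds(2)[OF cl'] by simp
      finally show ?case
        using \<delta> by (simp add: field_simps)
    qed
    have "tilt S \<mu> summable_on UNIV"
    proof (rule nonneg_bdd_above_summable_on)
      show "bdd_above (sum (tilt S \<mu>) ` {F. F \<subseteq> UNIV \<and> finite F})"
      proof (rule bdd_aboveI2)
        fix F :: "(int^'d) set" assume F: "F \<in> {F. F \<subseteq> UNIV \<and> finite F}"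
        \<comment> \<open>Fatou by hand: a finite partial sum at \<open>\<mu>\<close> is a limit of
          partial sums along the ray, each at most \<open>X n\<close>.\<close>
        have le: "sum (tilt S (t n *\<^sub>R \<mu>)) F \<le> X n" for n
          unfolding X_def using F in_Omega[of n]
          by (intro finite_sum_le_infsum) (auto simp: Omega_iff_summable S_nonneg tilt_def)
        show "sum (tilt S \<mu>) F \<le> M / \<delta>"
        proof (rule tendsto_upperbound)
          show "(\<lambda>n. sum (tilt S (t n *\<^sub>R \<mu>)) F) \<longlonglongrightarrow> sum (tilt S \<mu>) F"
            by (intro tendsto_sum tilt_lim)
          show "\<forall>\<^sub>F n in sequentially. sum (tilt S (t n *\<^sub>R \<mu>)) F \<le> M / \<delta>"
            using ev by eventually_elim (use le order_trans in blast)
        qed simp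
      qed
    qed (simp add: tilt_def S_nonneg)
    then show False
      using assms(2) by (simp add: Omega_iff_summable S_nonneg)
  qed
  ultimately show ?thesis
    unfolding \<phi>_def by fastforce
qed

section \<open>The infrared bound as positivity of the second derivative\<close>

lemma J_second_moment_summable:
  assumes "\<mu> \<in> closure (Omega S)"
  shows "(\<lambda>y. (norm (rvec y))\<^sup>2 * \<bar>tilt J \<mu> y\<bar>) summable_on UNIV"
  using second_moment_summable bounds[OF assms] M_pos \<zeta>_pos unfolding tilt_bounds_def by blast

lemma inner_sq_le: "(w \<bullet> rvec y)\<^sup>2 \<le> (norm w)\<^sup>2 * (norm (rvec y))\<^sup>2"
  using Cauchy_Schwarz_ineq[of w "rvec y"] by (simp add: power2_norm_eq_inner)

text \<open>Apply the infrared bound at a small multiple of \<open>w\<close>, rescale quadratically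
  and pass to the limit: 1 - cos becomes half a square. Terms may have either sign, so the limit is
  taken by dominated convergence with the second moment.\<close>

lemma J_second_moment_ge:
  assumes cl: "\<mu> \<in> closure (Omega S)"
  shows "(\<Sum>\<^sub>\<infinity>y. tilt J \<mu> y * ((w \<bullet> rvec y)\<^sup>2 / 2)) \<ge> K * (norm w)\<^sup>2"
proof -
  define F where "F n y = tilt J \<mu> y * ((1 - cos ((w \<bullet> rvec y) / real (Suc n))) * (real (Suc n))\<^sup>2)" for n y
  have lim: "(\<lambda>n. infsum (F n) UNIV) \<longlonglongrightarrow> (\<Sum>\<^sub>\<infinity>y. tilt J \<mu> y * ((w \<bullet> rvec y)\<^sup>2 / 2))"
  proof (rule infsum_dominated_convergence)
    show "(\<lambda>y. ((norm w)\<^sup>2 / 2) * ((norm (rvec y))\<^sup>2 * \<bar>tilt J \<mu> y\<bar>)) summable_on UNIV"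
      by (intro summable_on_cmult_right J_second_moment_summable cl)
    fix y :: "int^'d"
    define a where "a = w \<bullet> rvec y"
    have "(\<lambda>n. (1 - cos (a / real (Suc n))) * (real (Suc n))\<^sup>2) \<longlonglongrightarrow> a * a / 2"
      by real_asymp
    then show "(\<lambda>n. F n y) \<longlonglongrightarrow> tilt J \<mu> y * ((w \<bullet> rvec y)\<^sup>2 / 2)"
      unfolding F_def a_def power2_eq_square by (rule tendsto_mult_left)
    fix n
    have "(1 - cos (a / real (Suc n))) * (real (Suc n))\<^sup>2 \<le> (a / real (Suc n))\<^sup>2 / 2 * (real (Suc n))\<^sup>2"
      by (intro mult_right_mono one_minus_cos_le) auto
    also have "\<dots> = a\<^sup>2 / 2"
      by (simp add: power_divide)
    also have "\<dots> \<le> (norm w)\<^sup>2 / 2 * (norm (rvec y))\<^sup>2"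
      unfolding a_def using inner_sq_le[of w y] by simp
    finally have "\<bar>(1 - cos (a / real (Suc n))) * (real (Suc n))\<^sup>2\<bar> \<le> (norm w)\<^sup>2 / 2 * (norm (rvec y))\<^sup>2"
      by (simp add: abs_mult)
    then have "\<bar>tilt J \<mu> y\<bar> * \<bar>(1 - cos (a / real (Suc n))) * (real (Suc n))\<^sup>2\<bar>
        \<le> \<bar>tilt J \<mu> y\<bar> * ((norm w)\<^sup>2 / 2 * (norm (rvec y))\<^sup>2)"
      by (rule mult_left_mono) simp
    then show "\<bar>F n y\<bar> \<le> ((norm w)\<^sup>2 / 2) * ((norm (rvec y))\<^sup>2 * \<bar>tilt J \<mu> y\<bar>)"
      by (simp only: F_def a_def abs_mult mult_ac)
  qed
  \<comment> \<open>From such an n on, the rescaled frequency lies in the cube where the infrared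
    bound is stated.\<close>
  have "\<forall>\<^sub>F n in sequentially. norm w / real (Suc n) < pi"
    by real_asymp
  then have "\<forall>\<^sub>F n in sequentially. K * (norm w)\<^sup>2 \<le> infsum (F n) UNIV"
  proof eventually_elim
    case (elim n)
    define k where "k = (1 / real (Suc n)) *\<^sub>R w"
    have nk: "norm k = norm w / real (Suc n)"
      by (simp add: k_def)
    have "- pi \<le> k $ j \<and> k $ j \<le> pi" for j
      using component_le_norm_cart[of k j] elim nk by linarith
    then have "K * (norm k)\<^sup>2 \<le> Re (fourier (tilt J \<mu>) 0 - fourier (tilt J \<mu>) k)"
      using bounds[OF cl] by (simp add: tilt_bounds_def)
    also have "\<dots> = (\<Sum>\<^sub>\<infinity>y. tilt J \<mu> y * 1) - (\<Sum>\<^sub>\<infinity>y. tilt J \<mu> y * cos (k \<bullet> rvec y))"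
      by (simp add: Re_fourier J_summable cl)
    also have "\<dots> = (\<Sum>\<^sub>\<infinity>y. tilt J \<mu> y * 1 - tilt J \<mu> y * cos (k \<bullet> rvec y))"
    proof -
      have c: "(\<lambda>y. tilt J \<mu> y * cos (k \<bullet> rvec y)) summable_on UNIV"
        by (rule summable_on_bounded[of "\<lambda>y. \<bar>tilt J \<mu> y\<bar>"])
          (use J_summable[OF cl] summable_on_iff_abs_summable_on_real[of "tilt J \<mu>" UNIV] in
            \<open>auto simp: abs_mult mult_left_le\<close>)
      show ?thesis
        using infsum_add[OF J_summable[OF cl] summable_on_uminus[THEN iffD2, OF c]]
        by (simp add: infsum_uminus)
    qed
    also have "\<dots> = (\<Sum>\<^sub>\<infinity>y. F n y / (real (Suc n))\<^sup>2)"
      by (rule infsum_cong) (simp add: F_def k_def right_diff_distrib del: of_nat_Suc)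
    also have "\<dots> = infsum (F n) UNIV / (real (Suc n))\<^sup>2"
      using infsum_cmult_left'[of "F n" "1 / (real (Suc n))\<^sup>2" UNIV] by simp
    finally show ?case
      by (simp add: nk power_divide field_simps del: of_nat_Suc)
  qed
  then show ?thesis
    by (intro tendsto_lowerbound[OF lim]) auto
qed

text \<open>Symmetric second differences of the total mass of the tilted kernel along the segment would
  vanish, while their limit, the second derivative, is positive by the infrared bound.\<close>

lemma no_segment_in_boundary:
  assumes "w \<noteq> 0"
    and seg: "\<And>s. \<bar>s\<bar> \<le> 1 \<Longrightarrow> \<mu> + s *\<^sub>R w \<in> closure (Omega S) - Omega S"
  shows False
proof -
  have cl: "\<mu> + s *\<^sub>R w \<in> closure (Omega S)" if "\<bar>s\<bar> \<le> 1" for s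
    using seg[OF that] by blast
  have sum1: "infsum (tilt J (\<mu> + s *\<^sub>R w)) UNIV = 1" if "\<bar>s\<bar> \<le> 1" for s
    using seg[OF that] J_hat_boundary by blast
  have cl0: "\<mu> \<in> closure (Omega S)"
    using cl[of 0] by simp
  \<comment> \<open>Averaging the tilts at opposite displacements turns the exponential into a
    hyperbolic cosine.\<close>
  have cosh_tilt: "tilt J \<mu> y * cosh (s * (w \<bullet> rvec y)) =
      1/2 * (tilt J (\<mu> + s *\<^sub>R w) y + tilt J (\<mu> + (-s) *\<^sub>R w) y)" for s y
    by (simp add: tilt_def cosh_def inner_add_left inner_diff_left exp_add exp_diff exp_minus field_simps)
  \<comment> \<open>Half the symmetric second difference with step \<open>1 / Suc n\<close>, divided
    by the square of the step. It sums to 0 because the kernel has mass 1 at all three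
    points.\<close>
  define F where "F n y = tilt J \<mu> y * ((cosh ((w \<bullet> rvec y) / real (Suc n)) - 1) * (real (Suc n))\<^sup>2)" for n y
  have "infsum (F n) UNIV = 0" for n
  proof -
    define s where "s = 1 / real (Suc n)"
    have s: "\<bar>s\<bar> \<le> 1" "\<bar>-s\<bar> \<le> 1"
      by (auto simp: s_def)
    have "((\<lambda>y. (1/2 * (tilt J (\<mu> + s *\<^sub>R w) y + tilt J (\<mu> + (-s) *\<^sub>R w) y) + (- tilt J \<mu> y)) * (real (Suc n))\<^sup>2)
        has_sum (1/2 * (1 + 1) + (- 1)) * (real (Suc n))\<^sup>2) UNIV"
      using has_sum_infsum[OF J_summable[OF cl[OF s(1)]]] has_sum_infsum[OF J_summable[OF cl[OF s(2)]]]
        has_sum_infsum[OF J_summable[OF cl0]] sum1[OF s(1)] sum1[OF s(2)] sum1[of 0]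
      by (intro has_sum_cmult_left has_sum_cmult_right has_sum_add has_sum_uminusI) auto
    moreover have "(1/2 * (tilt J (\<mu> + s *\<^sub>R w) y + tilt J (\<mu> + (-s) *\<^sub>R w) y) + (- tilt J \<mu> y)) * (real (Suc n))\<^sup>2
        = F n y" for y
      unfolding cosh_tilt[symmetric] F_def by (simp add: s_def algebra_simps)
    ultimately show ?thesis
      by (simp add: infsumI)
  qed
  moreover have "(\<lambda>n. infsum (F n) UNIV) \<longlonglongrightarrow> (\<Sum>\<^sub>\<infinity>y. tilt J \<mu> y * ((w \<bullet> rvec y)\<^sup>2 / 2))"
  proof (rule infsum_dominated_convergence)
    \<comment> \<open>The factor cosh a is absorbed into the tilts at the two ends of the segment,
      whose second moments are finite. One 1/2 comes from the quadratic bound, the other from the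
      average.\<close>
    let ?g = "\<lambda>y. ((norm w)\<^sup>2 / 4) * ((norm (rvec y))\<^sup>2 * \<bar>tilt J (\<mu> + 1 *\<^sub>R w) y\<bar> + (norm (rvec y))\<^sup>2 * \<bar>tilt J (\<mu> + (-1) *\<^sub>R w) y\<bar>)"
    show "?g summable_on UNIV"
      by (intro summable_on_cmult_right summable_on_add J_second_moment_summable cl) auto
    fix y :: "int^'d"
    define a where "a = w \<bullet> rvec y"
    have "(\<lambda>n. (cosh (a / real (Suc n)) - 1) * (real (Suc n))\<^sup>2) \<longlonglongrightarrow> a * a / 2"
      unfolding cosh_def real_scaleR_def by real_asymp
    then show "(\<lambda>n. F n y) \<longlonglongrightarrow> tilt J \<mu> y * ((w \<bullet> rvec y)\<^sup>2 / 2)"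
      unfolding F_def a_def power2_eq_square by (rule tendsto_mult_left)
    fix n
    have "(cosh (a / real (Suc n)) - 1) * (real (Suc n))\<^sup>2
        \<le> (a / real (Suc n))\<^sup>2 / 2 * cosh (a / real (Suc n)) * (real (Suc n))\<^sup>2"
      by (intro mult_right_mono cosh_minus_1_le) auto
    also have "\<dots> = a\<^sup>2 / 2 * cosh (a / real (Suc n))"
      by (simp add: power_divide)
    also have "\<dots> \<le> a\<^sup>2 / 2 * cosh a"
    proof -
      have "cosh \<bar>a / real (Suc n)\<bar> \<le> cosh \<bar>a\<bar>"
        by (subst cosh_real_nonneg_le_iff) (auto simp: field_simps)
      then have "cosh (a / real (Suc n)) \<le> cosh a"
        by (simp only: cosh_real_abs)
      then show ?thesis
        by (rule mult_left_mono) simp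
    qed
    also have "\<dots> \<le> (norm w)\<^sup>2 * (norm (rvec y))\<^sup>2 / 2 * cosh a"
      unfolding a_def using inner_sq_le[of w y] by (intro mult_right_mono divide_right_mono) auto
    finally have "\<bar>(cosh (a / real (Suc n)) - 1) * (real (Suc n))\<^sup>2\<bar> \<le> (norm w)\<^sup>2 * (norm (rvec y))\<^sup>2 / 2 * cosh a"
      using cosh_real_ge_1 by (subst abs_of_nonneg) auto
    then have "\<bar>tilt J \<mu> y\<bar> * \<bar>(cosh (a / real (Suc n)) - 1) * (real (Suc n))\<^sup>2\<bar>
        \<le> \<bar>tilt J \<mu> y\<bar> * ((norm w)\<^sup>2 * (norm (rvec y))\<^sup>2 / 2 * cosh a)"
      by (rule mult_left_mono) simp
    also have "\<dots> = (norm w)\<^sup>2 * (norm (rvec y))\<^sup>2 / 2 * \<bar>tilt J \<mu> y * cosh (1 * (w \<bullet> rvec y))\<bar>"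
      by (simp add: abs_mult a_def)
    also have "\<dots> \<le> ?g y"
    proof -
      have "\<bar>tilt J \<mu> y * cosh (1 * (w \<bullet> rvec y))\<bar>
          \<le> 1/2 * (\<bar>tilt J (\<mu> + 1 *\<^sub>R w) y\<bar> + \<bar>tilt J (\<mu> + (-1) *\<^sub>R w) y\<bar>)"
        unfolding cosh_tilt[of y 1] by (simp add: abs_triangle_ineq)
      from mult_left_mono[OF this, of "(norm w)\<^sup>2 * (norm (rvec y))\<^sup>2 / 2"] show ?thesis
        by (simp add: algebra_simps)
    qed
    finally show "\<bar>F n y\<bar> \<le> ?g y"
      by (simp only: F_def a_def abs_mult)
  qed
  ultimately have "(\<Sum>\<^sub>\<infinity>y. tilt J \<mu> y * ((w \<bullet> rvec y)\<^sup>2 / 2)) = 0"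
    using LIMSEQ_unique[OF _ tendsto_const] by simp
  moreover have "K * (norm w)\<^sup>2 > 0"
    using K_pos assms(1) by simp
  ultimately show False
    using J_second_moment_ge[OF cl0, of w] by linarith
qed

end

section \<open>The support function of the domain\<close>

lemma Omega_reindex:
  assumes "bij g" and "\<And>x. S (g x) = S x" and inner: "\<And>x. \<nu> \<bullet> rvec x = \<mu> \<bullet> rvec (g x)"
    and "\<mu> \<in> Omega S"
  shows "\<nu> \<in> Omega S"
proof -
  have "chi S \<nu> = (\<Sum>\<^sub>\<infinity>x. ennreal (tilt S \<mu> (g x)))"
    by (simp add: chi_def tilt_def assms(2) inner)
  also have "\<dots> = chi S \<mu>"
    unfolding chi_def by (rule infsum_reindex_bij_betw[OF assms(1)])
  finally show ?thesis
    using assms(4) by (simp add: Omega_def)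
qed

lemma Omega_flip:
  assumes "zd_symmetric S" "\<mu> \<in> Omega S"
  shows "(\<chi> l. if l = j then - (\<mu> $ l) else \<mu> $ l) \<in> Omega S"
proof (rule Omega_reindex[OF _ _ _ assms(2)])
  let ?g = "\<lambda>x :: int^'a. \<chi> l. if l = j then - (x $ l) else x $ l"
  show "bij ?g"
    by (rule o_bij[of ?g]) (auto simp: fun_eq_iff vec_eq_iff)
  show "S (?g x) = S x" for x
    using assms(1) by (simp add: zd_symmetric_def)
  show "(\<chi> l. if l = j then - (\<mu> $ l) else \<mu> $ l) \<bullet> rvec x = \<mu> \<bullet> rvec (?g x)" for x
    unfolding inner_vec_def by (rule sum.cong) (auto simp: rvec_def)
qed

text \<open>A transposition is its own inverse, so it crosses the inner product unchanged. It serves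
  to carry one coordinate axis to another.\<close>

lemma Omega_transpose:
  assumes "zd_symmetric S" "\<mu> \<in> Omega S"
  shows "(\<chi> l. \<mu> $ Transposition.transpose a b l) \<in> Omega S"
proof (rule Omega_reindex[OF _ _ _ assms(2)])
  let ?g = "\<lambda>x :: int^'a. \<chi> l. x $ Transposition.transpose a b l"
  show "bij ?g"
    by (rule o_bij[of ?g]) (auto simp: fun_eq_iff vec_eq_iff)
  show "S (?g x) = S x" for x
    using assms(1) by (simp add: zd_symmetric_def)
  show "(\<chi> l. \<mu> $ Transposition.transpose a b l) \<bullet> rvec x = \<mu> \<bullet> rvec (?g x)" for x
  proof -
    have "(\<Sum>l\<in>UNIV. \<mu> $ Transposition.transpose a b l * real_of_int (x $ l)) =
        (\<Sum>l\<in>UNIV. \<mu> $ Transposition.transpose a b (Transposition.transpose a b l) * real_of_int (x $ Transposition.transpose a b l))"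
      by (rule sum.reindex_bij_betw[symmetric]) simp
    then show ?thesis
      by (simp add: inner_vec_def rvec_def)
  qed
qed

locale symmetric_weak_kernel = weak_kernel S J h M K \<zeta>
  for S J h :: "int^'d::finite \<Rightarrow> real" and M K \<zeta> :: real +
  fixes i :: 'd
  assumes symmetric: "zd_symmetric S"
    and not_all_axis: "\<exists>\<mu>\<^sub>1>0. \<mu>\<^sub>1 *\<^sub>R axis i 1 \<notin> Omega S"
begin

lemma Omega_uminus:
  assumes "\<mu> \<in> Omega S"
  shows "- \<mu> \<in> Omega S"
proof -
  \<comment> \<open>The reflection through the origin is built by flipping one coordinate at a
    time.\<close>
  have "(\<chi> l. if l \<in> A then - (\<mu> $ l) else \<mu> $ l) \<in> Omega S" if "finite A" for A
    using that
  proof induction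
    case empty
    then show ?case using assms by simp
  next
    case (insert j A)
    have "(\<chi> l. if l \<in> insert j A then - (\<mu> $ l) else \<mu> $ l) =
        (\<chi> l. if l = j then - ((\<chi> l. if l \<in> A then - (\<mu> $ l) else \<mu> $ l) $ l)
          else (\<chi> l. if l \<in> A then - (\<mu> $ l) else \<mu> $ l) $ l)"
      using insert.hyps by (auto simp: vec_eq_iff)
    with Omega_flip[OF symmetric insert.IH, of j] show ?case by simp
  qed
  from this[OF finite_class.finite_UNIV] show ?thesis
    by (simp add: uminus_vec_def)
qed

text \<open>Averaging a point with its reflection sets one coordinate to \<open>0\<close>.\<close>

lemma Omega_zero_coordinates:
  assumes "\<mu> \<in> Omega S" "finite A"
  shows "(\<chi> l. if l \<in> A then 0 else \<mu> $ l) \<in> Omega S"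
  using assms(2)
proof induction
  case empty
  then show ?case using assms by simp
next
  case (insert j A)
  let ?p = "\<chi> l. if l \<in> A then 0 else \<mu> $ l"
  have "(1/2) *\<^sub>R ?p + (1/2) *\<^sub>R (\<chi> l. if l = j then - (?p $ l) else ?p $ l) \<in> Omega S"
    by (rule convexD[OF convex insert.IH Omega_flip[OF symmetric insert.IH]]) auto
  moreover have "(1/2) *\<^sub>R ?p + (1/2) *\<^sub>R (\<chi> l. if l = j then - (?p $ l) else ?p $ l)
      = (\<chi> l. if l \<in> insert j A then 0 else \<mu> $ l)"
    by (auto simp: vec_eq_iff)
  ultimately show ?case by simp
qed

lemma Omega_axis:
  assumes "t *\<^sub>R axis a 1 \<in> Omega S"
  shows "t *\<^sub>R axis b 1 \<in> Omega S"
proof -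
  have "(\<chi> l. (t *\<^sub>R axis a (1::real)) $ Transposition.transpose a b l) = t *\<^sub>R axis b 1"
    by (auto simp: vec_eq_iff axis_def transpose_eq_iff)
  then show ?thesis
    using Omega_transpose[OF symmetric assms, of a b] by simp
qed

text \<open>Project onto axis \<open>j\<close>, reflect to make the coefficient nonnegative, then
  swap axes. This compares every coordinate with the mass along \<open>i\<close>.\<close>

lemma Omega_coordinate:
  assumes "\<mu> \<in> Omega S"
  shows "\<bar>\<mu> $ j\<bar> *\<^sub>R axis b 1 \<in> Omega S"
proof -
  have "(\<chi> l. if l \<in> - {j} then 0 else \<mu> $ l) = (\<mu> $ j) *\<^sub>R axis j 1"
    by (auto simp: vec_eq_iff axis_def)
  then have "(\<mu> $ j) *\<^sub>R axis j 1 \<in> Omega S"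
    using Omega_zero_coordinates[OF assms, of "- {j}"] by simp
  then have "\<bar>\<mu> $ j\<bar> *\<^sub>R axis j 1 \<in> Omega S"
    using Omega_uminus by (fastforce simp: abs_if)
  then show ?thesis
    by (rule Omega_axis)
qed

section \<open>The mass and the enclosing cube\<close>

lemma mass_eq: "mass i S = Sup {t. 0 \<le> t \<and> t *\<^sub>R axis i 1 \<in> Omega S}"
  by (simp add: mass_def Omega_def)

text \<open>By convexity the domain contains the segment from 0 to each of its points, so it cannot
  reach beyond an excluded point of the axis.\<close>

lemma bdd_above_mass_set: "bdd_above {t. 0 \<le> t \<and> t *\<^sub>R axis i 1 \<in> Omega S}"
proof -
  obtain m1 where m1: "m1 > 0" "m1 *\<^sub>R axis i 1 \<notin> Omega S"
    using not_all_axis by blast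
  show ?thesis
  proof (rule bdd_aboveI)
    fix t assume "t \<in> {t. 0 \<le> t \<and> t *\<^sub>R axis i 1 \<in> Omega S}"
    then have t: "t *\<^sub>R axis i 1 \<in> Omega S" by simp
    show "t \<le> m1"
    proof (rule ccontr)
      assume "\<not> t \<le> m1"
      then have "(m1 / t) *\<^sub>R (t *\<^sub>R axis i 1) + (1 - m1 / t) *\<^sub>R 0 \<in> Omega S"
        using m1 by (intro convexD[OF convex t zero_in_Omega]) auto
      then show False
        using m1 \<open>\<not> t \<le> m1\<close> by simp
    qed
  qed
qed

lemma mass_pos: "mass i S > 0"
proof -
  obtain e where e: "e > 0" "ball 0 e \<subseteq> Omega S"
    using open_Omega zero_in_Omega openE by blast
  then have "(e / 2) *\<^sub>R axis i 1 \<in> Omega S"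
    by (intro subsetD[OF e(2)]) simp
  then have "e / 2 \<le> mass i S"
    unfolding mass_eq using e by (intro cSup_upper bdd_above_mass_set) auto
  then show ?thesis using e by linarith
qed

text \<open>On the domain itself this is the projection to the axis; the condition is closed, so it
  extends to the closure.\<close>

lemma coordinate_le_mass:
  assumes "\<mu> \<in> closure (Omega S)"
  shows "\<bar>\<mu> $ j\<bar> \<le> mass i S"
proof -
  have "closed {\<mu> :: real^'d. \<bar>\<mu> $ j\<bar> \<le> mass i S}"
    by (intro closed_Collect_le continuous_intros)
  moreover have "\<bar>\<mu> $ j\<bar> \<le> mass i S" if "\<mu> \<in> Omega S" for \<mu>
    unfolding mass_eq using Omega_coordinate[OF that] by (intro cSup_upper bdd_above_mass_set) auto
  ultimately have "closure (Omega S) \<subseteq> {\<mu>. \<bar>\<mu> $ j\<bar> \<le> mass i S}"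
    by (intro closure_minimal) auto
  then show ?thesis using assms by blast
qed

lemma closure_Omega_uminus:
  assumes "\<mu> \<in> closure (Omega S)"
  shows "- \<mu> \<in> closure (Omega S)"
proof -
  have "uminus ` closure (Omega S) \<subseteq> closure (Omega S)"
    using Omega_uminus closure_subset by (intro image_closure_subset continuous_intros) auto
  then show ?thesis using assms by blast
qed

lemma compact_closure_Omega: "compact (closure (Omega S))"
proof -
  have "norm \<mu> \<le> (\<Sum>j\<in>(UNIV :: 'd set). mass i S)" if "\<mu> \<in> closure (Omega S)" for \<mu>
    using norm_le_l1_cart[of \<mu>] sum_mono[of UNIV "\<lambda>j. \<bar>\<mu> $ j\<bar>" "\<lambda>_. mass i S"]
      coordinate_le_mass[OF that] by fastforce
  then have "bounded (closure (Omega S))"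
    by (rule boundedI)
  then show ?thesis
    by (simp add: compact_eq_bounded_closed)
qed

text \<open>Compactness gives existence. Two distinct maximisers would span a segment on which the
  functional is maximal; it misses the open domain and so lies in the boundary, which contains no
  segment.\<close>

lemma ex1_arg_max:
  assumes "u \<noteq> 0"
  shows "\<exists>!\<mu>. is_arg_max (\<lambda>\<nu>. \<nu> \<bullet> u) (\<lambda>\<nu>. \<nu> \<in> closure (Omega S)) \<mu>"
proof (rule ex_ex1I)
  have "closure (Omega S) \<noteq> {}"
    using zero_in_Omega closure_subset by blast
  moreover have "continuous_on (closure (Omega S)) (\<lambda>\<nu>. \<nu> \<bullet> u)"
    by (intro continuous_intros)
  ultimately obtain \<mu> where "\<mu> \<in> closure (Omega S)" "\<forall>\<nu>\<in>closure (Omega S). \<nu> \<bullet> u \<le> \<mu> \<bullet> u"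
    using continuous_attains_sup[OF compact_closure_Omega] by blast
  then show "\<exists>\<mu>. is_arg_max (\<lambda>\<nu>. \<nu> \<bullet> u) (\<lambda>\<nu>. \<nu> \<in> closure (Omega S)) \<mu>"
    by (auto simp: is_arg_max_linorder)
next
  fix \<mu> \<nu>
  assume "is_arg_max (\<lambda>\<nu>. \<nu> \<bullet> u) (\<lambda>\<nu>. \<nu> \<in> closure (Omega S)) \<mu>"
    and "is_arg_max (\<lambda>\<nu>. \<nu> \<bullet> u) (\<lambda>\<nu>. \<nu> \<in> closure (Omega S)) \<nu>"
  then have cl: "\<mu> \<in> closure (Omega S)" "\<nu> \<in> closure (Omega S)"
    and max: "\<And>\<kappa>. \<kappa> \<in> closure (Omega S) \<Longrightarrow> \<kappa> \<bullet> u \<le> \<mu> \<bullet> u" and eq: "\<mu> \<bullet> u = \<nu> \<bullet> u"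
    by (auto simp: is_arg_max_linorder intro: antisym)
  show "\<mu> = \<nu>"
  proof (rule ccontr)
    assume "\<mu> \<noteq> \<nu>"
    then have w: "(1/2) *\<^sub>R (\<mu> - \<nu>) \<noteq> 0" by simp
    \<comment> \<open>The segment is centred at the midpoint, with s = 1 and s = -1 giving
      \<open>\<mu>\<close> and \<open>\<nu>\<close>.\<close>
    have "(1/2) *\<^sub>R (\<mu> + \<nu>) + s *\<^sub>R ((1/2) *\<^sub>R (\<mu> - \<nu>)) \<in> closure (Omega S) - Omega S"
      if "\<bar>s\<bar> \<le> 1" for s
    proof -
      let ?p = "(1/2) *\<^sub>R (\<mu> + \<nu>) + s *\<^sub>R ((1/2) *\<^sub>R (\<mu> - \<nu>))"
      have "?p = ((1 + s) / 2) *\<^sub>R \<mu> + ((1 - s) / 2) *\<^sub>R \<nu>"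
        by (simp add: vec_eq_iff field_simps)
      moreover have "((1 + s) / 2) *\<^sub>R \<mu> + ((1 - s) / 2) *\<^sub>R \<nu> \<in> closure (Omega S)"
        using that by (intro convexD[OF convex_closure[OF convex] cl]) (auto simp: field_simps)
      ultimately have in_cl: "?p \<in> closure (Omega S)" by simp
      have pu: "?p \<bullet> u = \<mu> \<bullet> u"
        by (simp add: inner_add_left inner_diff_left eq)
      have "?p \<notin> Omega S"
      proof
        assume "?p \<in> Omega S"
        then obtain e where e: "e > 0" "ball ?p e \<subseteq> Omega S"
          using open_Omega openE by blast
        \<comment> \<open>A displacement of length e/2 along \<open>u\<close> stays in the ball but
          increases the functional beyond its maximum.\<close>
        have "?p + (e / (2 * norm u)) *\<^sub>R u \<in> ball ?p e"
          using e assms by (simp add: dist_norm)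
        then have "(?p + (e / (2 * norm u)) *\<^sub>R u) \<bullet> u \<le> \<mu> \<bullet> u"
          using e closure_subset by (intro max) blast
        moreover have "(?p + (e / (2 * norm u)) *\<^sub>R u) \<bullet> u = \<mu> \<bullet> u + e / (2 * norm u) * (u \<bullet> u)"
          using pu by (simp only: inner_add_left inner_scaleR_left)
        moreover have "e / (2 * norm u) * (u \<bullet> u) > 0"
          using e assms by simp
        ultimately show False by linarith
      qed
      with in_cl show ?thesis by blast
    qed
    with w show False
      by (rule no_segment_in_boundary)
  qed
qed

section \<open>The norm as a support function\<close>

lemma mu_dir_max:
  assumes "x \<noteq> 0"
  shows "mu_dir S (sgn x) \<in> closure (Omega S)"
    and "\<nu> \<in> closure (Omega S) \<Longrightarrow> \<nu> \<bullet> x \<le> mu_dir S (sgn x) \<bullet> x"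
proof -
  have "is_arg_max (\<lambda>\<nu>. \<nu> \<bullet> sgn x) (\<lambda>\<nu>. \<nu> \<in> closure (Omega S)) (mu_dir S (sgn x))"
    unfolding mu_dir_def by (rule theI'[OF ex1_arg_max]) (use assms in \<open>simp add: sgn_zero_iff\<close>)
  then have *: "mu_dir S (sgn x) \<in> closure (Omega S)"
    "\<And>\<nu>. \<nu> \<in> closure (Omega S) \<Longrightarrow> \<nu> \<bullet> sgn x \<le> mu_dir S (sgn x) \<bullet> sgn x"
    by (auto simp: is_arg_max_linorder)
  show "mu_dir S (sgn x) \<in> closure (Omega S)" by (rule *)
  show "\<nu> \<bullet> x \<le> mu_dir S (sgn x) \<bullet> x" if "\<nu> \<in> closure (Omega S)"
    using *(2)[OF that] assms by (simp add: sgn_div_norm field_simps)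
qed

text \<open>Together with \<open>norm_S_ge\<close> this identifies \<open>norm_S\<close> as the
  support function of the closed domain divided by the mass. At \<open>x = 0\<close> the point 0
  serves as witness.\<close>

lemma norm_S_attained: "\<exists>\<mu>\<in>closure (Omega S). norm_S i S x = \<mu> \<bullet> x / mass i S"
  using mu_dir_max(1)[of x] zero_in_Omega closure_subset[of "Omega S"] by (auto simp: norm_S_def)

lemma norm_S_ge:
  assumes "\<mu> \<in> closure (Omega S)"
  shows "\<mu> \<bullet> x / mass i S \<le> norm_S i S x"
  using mu_dir_max(2)[OF _ assms, of x] mass_pos by (auto simp: norm_S_def divide_right_mono)

lemma norm_S_le_l1: "norm_S i S x \<le> (\<Sum>j\<in>UNIV. \<bar>x $ j\<bar>)"
proof -
  obtain \<mu> where \<mu>: "\<mu> \<in> closure (Omega S)" "norm_S i S x = \<mu> \<bullet> x / mass i S"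
    using norm_S_attained by blast
  have "\<mu> \<bullet> x \<le> (\<Sum>j\<in>UNIV. mass i S * \<bar>x $ j\<bar>)"
    unfolding inner_vec_def
  proof (rule sum_mono)
    fix j
    have "\<mu> $ j \<bullet> x $ j \<le> \<bar>\<mu> $ j\<bar> * \<bar>x $ j\<bar>"
      by (simp flip: abs_mult)
    also have "\<dots> \<le> mass i S * \<bar>x $ j\<bar>"
      by (intro mult_right_mono coordinate_le_mass \<mu>) auto
    finally show "\<mu> $ j \<bullet> x $ j \<le> mass i S * \<bar>x $ j\<bar>" .
  qed
  then show ?thesis
    unfolding \<mu>(2) using mass_pos by (simp add: field_simps flip: sum_distrib_left)
qed

text \<open>Test the support function at signed multiples of the axis vector \<open>j\<close>, with
  length approaching the mass.\<close>

lemma coordinate_le_norm_S: "\<bar>x $ j\<bar> \<le> norm_S i S x"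
proof (cases "x $ j = 0")
  case True
  then show ?thesis
    using norm_S_ge[of 0 x] zero_in_Omega closure_subset[of "Omega S"] by auto
next
  case False
  \<comment> \<open>The mass is a supremum, so the inequality is first proved as an upper bound for
    each admissible t.\<close>
  have "Sup {t. 0 \<le> t \<and> t *\<^sub>R axis i 1 \<in> Omega S} \<le> norm_S i S x * mass i S / \<bar>x $ j\<bar>"
  proof (rule cSup_least)
    show "{t. 0 \<le> t \<and> t *\<^sub>R axis i 1 \<in> Omega S} \<noteq> {}"
      using zero_in_Omega by (auto intro: exI[of _ 0])
    fix t assume "t \<in> {t. 0 \<le> t \<and> t *\<^sub>R axis i 1 \<in> Omega S}"
    then have t: "t *\<^sub>R axis j 1 \<in> Omega S"
      using Omega_axis by blast
    have "sgn (x $ j) *\<^sub>R (t *\<^sub>R axis j 1) \<in> closure (Omega S)"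
      using t Omega_uminus[OF t] zero_in_Omega closure_subset[of "Omega S"] by (auto simp: sgn_if)
    then have "(sgn (x $ j) *\<^sub>R (t *\<^sub>R axis j 1)) \<bullet> x / mass i S \<le> norm_S i S x"
      by (rule norm_S_ge)
    then have "t * \<bar>x $ j\<bar> \<le> norm_S i S x * mass i S"
      using mass_pos by (simp add: inner_axis' field_simps abs_sgn)
    then show "t \<le> norm_S i S x * mass i S / \<bar>x $ j\<bar>"
      using False by (simp add: field_simps)
  qed
  then have "mass i S \<le> norm_S i S x * mass i S / \<bar>x $ j\<bar>"
    by (simp only: mass_eq[symmetric])
  then show ?thesis
    using False mass_pos by (simp add: field_simps)
qed

lemma infnorm_le_norm_S: "infnorm x \<le> norm_S i S x"
  using coordinate_le_norm_S[of x] by (auto simp: infnorm_Max Basis_vec_def inner_axis)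

text \<open>If \<open>\<mu>\<close> is optimal for the scaled vector, then
  \<open>sgn c *\<^sub>R \<mu>\<close> is a valid test point for \<open>x\<close>, by reflection
  symmetry. Applying the bound again with \<open>inverse c\<close> gives equality.\<close>

lemma norm_S_scaleR_le: "norm_S i S (c *\<^sub>R x) \<le> \<bar>c\<bar> * norm_S i S x"
proof -
  obtain \<mu> where \<mu>: "\<mu> \<in> closure (Omega S)" "norm_S i S (c *\<^sub>R x) = \<mu> \<bullet> (c *\<^sub>R x) / mass i S"
    using norm_S_attained by blast
  have "sgn c *\<^sub>R \<mu> \<in> closure (Omega S)"
    using \<mu>(1) closure_Omega_uminus[OF \<mu>(1)] zero_in_Omega closure_subset[of "Omega S"]
    by (auto simp: sgn_if)
  from mult_left_mono[OF norm_S_ge[OF this, of x], of "\<bar>c\<bar>"]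
  have "\<bar>c\<bar> * ((sgn c *\<^sub>R \<mu>) \<bullet> x / mass i S) \<le> \<bar>c\<bar> * norm_S i S x"
    by simp
  moreover have "\<bar>c\<bar> * ((sgn c *\<^sub>R \<mu>) \<bullet> x / mass i S) = norm_S i S (c *\<^sub>R x)"
    unfolding \<mu>(2) by (simp add: sgn_if)
  ultimately show ?thesis by simp
qed

lemma norm_S_scaleR: "norm_S i S (c *\<^sub>R x) = \<bar>c\<bar> * norm_S i S x"
proof (cases "c = 0")
  case False
  have "norm_S i S (inverse c *\<^sub>R (c *\<^sub>R x)) \<le> \<bar>inverse c\<bar> * norm_S i S (c *\<^sub>R x)"
    by (rule norm_S_scaleR_le)
  then have "\<bar>c\<bar> * norm_S i S x \<le> norm_S i S (c *\<^sub>R x)"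
    using False by (simp add: field_simps)
  then show ?thesis
    using norm_S_scaleR_le[of c x] by linarith
qed (simp add: norm_S_def)

text \<open>The maximiser for the sum is a test point for each summand.\<close>

lemma norm_S_triangle: "norm_S i S (x + y) \<le> norm_S i S x + norm_S i S y"
proof -
  obtain \<mu> where \<mu>: "\<mu> \<in> closure (Omega S)" "norm_S i S (x + y) = \<mu> \<bullet> (x + y) / mass i S"
    using norm_S_attained by blast
  then show ?thesis
    using norm_S_ge[OF \<mu>(1), of x] norm_S_ge[OF \<mu>(1), of y]
    by (simp add: inner_add_right add_divide_distrib)
qed

lemma is_norm_norm_S: "is_norm (norm_S i S)"
  unfolding is_norm_def
proof (intro conjI allI)
  fix x y :: "real^'d" and c :: real
  show "0 \<le> norm_S i S x"
    using infnorm_le_norm_S[of x] infnorm_pos_le[of x] by linarith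
  \<comment> \<open>Definiteness is inherited from the maximum norm, which bounds
    \<open>norm_S\<close> from below.\<close>
  show "norm_S i S x = 0 \<longleftrightarrow> x = 0"
    using infnorm_le_norm_S[of x] infnorm_pos_le[of x] infnorm_eq_0[of x] by (auto simp: norm_S_def)
qed (rule norm_S_scaleR norm_S_triangle)+

end

theorem corollary1p5:
  fixes S :: "int^'d::finite \<Rightarrow> real" and i :: 'd
  assumes "\<forall>x. S x \<ge> 0"
    and "assumption1 i S"
    and "weak_assumption2 S"
  shows "is_norm (norm_S i S) \<and>
    (\<forall>x. infnorm x \<le> norm_S i S x \<and> norm_S i S x \<le> (\<Sum>j\<in>UNIV. \<bar>x $ j\<bar>))"
proof -
  obtain M K \<zeta> J h where "M > 0" "K > 0" "\<zeta> > 0" "\<forall>x. S x = h x + conv J S x"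
    and "\<forall>\<mu>\<in>closure (Omega S). Re (fourier (tilt h \<mu>) 0) > 0 \<and>
      tilt_bounds M K \<zeta> (tilt J \<mu>) (tilt h \<mu>)"
    using assms(3) unfolding weak_assumption2_def by blast
  then interpret symmetric_weak_kernel S J h M K \<zeta> i
    using assms(1,2) unfolding assumption1_def by unfold_locales blast+
  show ?thesis
    using is_norm_norm_S infnorm_le_norm_S norm_S_le_l1 by blast
qed

end
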